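(* Let $p,q$ be positive integers. The partitioning orbitope $\mathrm{O}^{=}_{p,q}(\mathfrak{C}_q)$ for the cyclic group $\mathfrak{C}_q$ equals the set of all $x \in \mathbb{R}^{[p]\times[q]}$ that satisfy the following linear constraints: (a) the equations $x_{11} = 1$ and $x_{1j} = 0$ for all $2 \le j \le q$; (b) the nonnegativity constraints $x_{ij} \ge 0$ for all $2 \le i \le p$ and $j \in [q]$; (c) the row-sum equations $x(\mathrm{row}_i) = 1$ for all $2 \le i \le p$. This system of constraints is non-redundant.
   Context: Notation: $[n]=\{1,\dots,n\}$; $\mathrm{row}_i=\{(i,1),\dots,(i,q)\}$; $x(T)=\sum_{(i,j)\in T}x_{ij}$ for $T\subseteq[p]\times[q]$. $\mathfrak{C}_q$ is the cyclic group of all $q$ cyclic permutations of $[q]$, acting on $0/1$-matrices of size $p\times q$ by permuting columns. Let $\prec$ be the lexicographic order on $\{0,1\}^{[p]\times[q]}$ with respect to the row-wise ordering $(1,1)<(1,2)<\dots<(1,q)<(2,1)<\dots<(p,q)$ of positions, i.e. $A\prec B$ iff $a_{k\ell}<b_{k\ell}$ at the first position $(k,\ell)$ where $A=(a_{ij})$ and $B=(b_{ij})$ differ. The partitioning orbitope $\mathrm{O}^{=}_{p,q}(\mathfrak{C}_q)$ is the convex hull in $\mathbb{R}^{[p]\times[q]}$ of all $0/1$-matrices of size $p\times q$ with exactly one $1$-entry in each row that are $\prec$-maximal within their $\mathfrak{C}_q$-orbit. A system of constraints is non-redundant if dropping any of the constraints enlarges its solution set.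
   Formalization: Non-redundancy is claimed only if q ≥ 2 or p = 1: for q = 1 and p ≥ 2 it fails, since the row-sum equation x_{i1} = 1 already implies x_{i1} ≥ 0; the description of the orbitope is for all p, q. *)

theory Defs
  imports "HOL-Analysis.Analysis" "HOL-Combinatorics.Cycles"
begin

text \<open>
  A \<open>p \<times> q\<close> matrix is an element of \<open>real ^ 'q ^ 'p\<close> (entry \<open>A $ i $ j\<close> in row \<open>i\<close>, column \<open>j\<close>).
  The index types are arbitrary finite linear orders; they play the roles of \<open>{1..p}\<close> and
  \<open>{1..q}\<close>, with \<open>Min UNIV\<close> as the index \<open>1\<close>.
\<close>
type_synonym ('p, 'q) rmatrix = "real^'q^'p"

subsection \<open>The cyclic group and its action on columns\<close>

text \<open>The cycle \<open>1 \<mapsto> 2 \<mapsto> \<dots> \<mapsto> q \<mapsto> 1\<close>.\<close>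
definition cyclic_shift :: "'q::{finite,linorder} \<Rightarrow> 'q" where
  "cyclic_shift = cycle_of_list (sorted_list_of_set UNIV)"

definition cyclic_perms :: "('q::{finite,linorder} \<Rightarrow> 'q) set" where
  "cyclic_perms = {cyclic_shift ^^ s | s. True}"

definition permute_columns :: "('q::finite \<Rightarrow> 'q) \<Rightarrow> ('p::finite, 'q) rmatrix \<Rightarrow> ('p, 'q) rmatrix" where
  "permute_columns \<sigma> A = (\<chi> i j. A $ i $ (inv \<sigma> j))"

definition cyclic_orbit :: "('p::finite, 'q::{finite,linorder}) rmatrix \<Rightarrow> ('p, 'q) rmatrix set" where
  "cyclic_orbit A = (\<lambda>\<sigma>. permute_columns \<sigma> A) ` cyclic_perms"


subsection \<open>The partitioning orbitope\<close>

definition lex_less ::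
  "('p::{finite,linorder}, 'q::{finite,linorder}) rmatrix \<Rightarrow> ('p, 'q) rmatrix \<Rightarrow> bool" where
  "lex_less A B \<longleftrightarrow>
     (\<exists>k l. A $ k $ l < B $ k $ l \<and>
            (\<forall>i j. i < k \<or> (i = k \<and> j < l) \<longrightarrow> A $ i $ j = B $ i $ j))"

definition partitioning_matrices :: "('p::finite, 'q::finite) rmatrix set" where
  "partitioning_matrices =
     {A. (\<forall>i j. A $ i $ j \<in> {0, 1}) \<and> (\<forall>i. \<exists>!j. A $ i $ j = 1)}"

definition partitioning_orbitope ::
  "('p::{finite,linorder}, 'q::{finite,linorder}) rmatrix set" where
  "partitioning_orbitope =
     convex hull {A \<in> partitioning_matrices. \<forall>B \<in> cyclic_orbit A. \<not> lex_less A B}"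


subsection \<open>Systems of linear constraints\<close>

text \<open>
  Constraints are kept as coefficient data, rather than as predicates or half-spaces, so that a
  system does not identify different constraints that have the same solutions.
\<close>
datatype 'a lin_constraint = LinEq 'a real | LinGe 'a real

fun satisfies :: "'a::real_inner \<Rightarrow> 'a lin_constraint \<Rightarrow> bool" where
  "satisfies x (LinEq a b) \<longleftrightarrow> a \<bullet> x = b"
| "satisfies x (LinGe a b) \<longleftrightarrow> a \<bullet> x \<ge> b"

definition solutions :: "'a::real_inner lin_constraint set \<Rightarrow> 'a set" where
  "solutions S = {x. \<forall>c\<in>S. satisfies x c}"

text \<open>
  The orbitope system below is redundant when \<open>q = 1\<close> and \<open>p \<ge> 2\<close>: in each row \<open>i > 1\<close> the
  equation \<open>x\<^sub>i\<^sub>1 = 1\<close> then implies \<open>x\<^sub>i\<^sub>1 \<ge> 0\<close>. Non-redundancy can be claimed only when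
  \<open>q \<ge> 2\<close> or \<open>p = 1\<close>.
\<close>
definition nonredundant :: "'a::real_inner lin_constraint set \<Rightarrow> bool" where
  "nonredundant S \<longleftrightarrow> (\<forall>c\<in>S. solutions S \<subset> solutions (S - {c}))"

text \<open>\<open>form_of T\<close> is the coefficient matrix of the linear form \<open>x \<mapsto> x(T)\<close>.\<close>
definition form_of :: "('p::finite \<times> 'q::finite) set \<Rightarrow> ('p, 'q) rmatrix" where
  "form_of T = (\<chi> i j. if (i, j) \<in> T then 1 else 0)"

definition row_positions :: "'p \<Rightarrow> ('p \<times> 'q) set" where
  "row_positions i = {i} \<times> UNIV"

definition first :: "'a::{finite,linorder}" where
  "first = Min UNIV"

definition orbitope_system ::
  "('p::{finite,linorder}, 'q::{finite,linorder}) rmatrix lin_constraint set" where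
  "orbitope_system =
     {LinEq (form_of {(first, first)}) 1} \<union>
     {LinEq (form_of {(first, j)}) 0 | j. j > first} \<union>
     {LinGe (form_of {(i, j)}) 0 | i j. i > first} \<union>
     {LinEq (form_of (row_positions i)) 1 | i. i > first}"


subsection \<open>Consistency checks\<close>

lemma form_of_inner: "form_of T \<bullet> x = (\<Sum>(i,j)\<in>T. x $ i $ j)"
proof -
  have "form_of T \<bullet> x = (\<Sum>i\<in>UNIV. \<Sum>j\<in>UNIV. if (i, j) \<in> T then x $ i $ j else 0)"
    unfolding form_of_def inner_vec_def by (intro sum.cong) auto
  also have "\<dots> = (\<Sum>z\<in>UNIV. if z \<in> T then x $ fst z $ snd z else 0)"
    by (simp add: sum.cartesian_product case_prod_unfold)
  also have "\<dots> = (\<Sum>(i,j)\<in>T. x $ i $ j)"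
    by (simp add: sum.If_cases case_prod_unfold)
  finally show ?thesis .
qed

lemma solutions_orbitope_system:
  fixes x :: "('p::{finite,linorder}, 'q::{finite,linorder}) rmatrix"
  shows "x \<in> solutions orbitope_system \<longleftrightarrow>
     x $ first $ first = 1 \<and> (\<forall>j>first. x $ first $ j = 0) \<and>
     (\<forall>i>first. \<forall>j. x $ i $ j \<ge> 0) \<and> (\<forall>i>first. (\<Sum>j\<in>UNIV. x $ i $ j) = 1)"
proof -
  have row: "(\<Sum>(i,j)\<in>row_positions i. x $ i $ j) = (\<Sum>j\<in>UNIV. x $ i $ j)" for i
    by (simp add: row_positions_def sum.cartesian_product[symmetric])
  have split: "(\<forall>c\<in>{f i |i. P i}. Q c) \<longleftrightarrow> (\<forall>i. P i \<longrightarrow> Q (f i))"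
    for f :: "'c \<Rightarrow> ('p, 'q) rmatrix lin_constraint" and P Q by auto
  have split2: "(\<forall>c\<in>{f i j |i j. P i j}. Q c) \<longleftrightarrow> (\<forall>i j. P i j \<longrightarrow> Q (f i j))"
    for f :: "'c \<Rightarrow> 'd \<Rightarrow> ('p, 'q) rmatrix lin_constraint" and P Q by auto
  show ?thesis
    unfolding solutions_def orbitope_system_def mem_Collect_eq ball_Un split split2
    by (auto simp: form_of_inner row)
qed

lemma cyclic_shift_nth:
  fixes cs :: "'q::{finite,linorder} list"
  defines "cs \<equiv> sorted_list_of_set UNIV"
  assumes "k < CARD('q)"
  shows "(cyclic_shift ^^ s) (cs ! k) = cs ! ((k + s) mod CARD('q))"
proof -
  have len: "length cs = CARD('q)" by (simp add: cs_def)
  have "map (cyclic_shift ^^ s) cs = rotate s cs"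
    unfolding cyclic_shift_def cs_def by (rule cyclic_rotation) simp
  then have "(cyclic_shift ^^ s) (cs ! k) = rotate s cs ! k"
    using assms(2) len by (metis nth_map)
  then show ?thesis
    using assms(2) len by (simp add: nth_rotate add.commute)
qed

end

theory Submission
  imports Defs
begin

text \<open>
  A partitioning matrix is lexicographically maximal in its orbit iff its first row is the first
  unit vector: the cyclic group acts regularly on the columns, so exactly one rotation moves the
  \<open>1\<close> of the first row to the front. The maximal matrices therefore correspond to the functions \<open>f\<close>
  from rows to columns with \<open>f 1 = 1\<close>, and a solution \<open>x\<close> of the system is the convex combination
  of these matrices with weights \<open>\<Prod>\<^sub>i x\<^sub>i\<^sub>,\<^sub>f\<^sub>(\<^sub>i\<^sub>)\<close>, the law of independent choices in the rows.
  Non-redundancy is witnessed by modifying a single row of the matrix with first column \<open>1\<close>.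
\<close>

section \<open>Cyclic shifts of the columns and lexicographically maximal matrices\<close>

lemma first_le: "(first :: 'a::{finite,linorder}) \<le> a"
  by (simp add: first_def)

lemma first_less_iff: "(first :: 'a::{finite,linorder}) < a \<longleftrightarrow> a \<noteq> first"
  using first_le[of a] by auto

lemma first_nth: "(first :: 'q::{finite,linorder}) = sorted_list_of_set UNIV ! 0"
proof -
  have "sorted_list_of_set (UNIV :: 'q set) =
      Min UNIV # sorted_list_of_set (UNIV - {Min UNIV})"
    by (rule sorted_list_of_set_nonempty) simp_all
  then show ?thesis by (simp add: first_def)
qed

lemma column_nth:
  fixes j :: "'q::{finite,linorder}"
  obtains k where "k < CARD('q)" "j = sorted_list_of_set UNIV ! k"
proof -
  have "j \<in> set (sorted_list_of_set UNIV)" by simp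
  then show ?thesis using that by (metis in_set_conv_nth length_sorted_list_of_set)
qed

lemma cyclic_shift_power_eq_id:
  assumes "CARD('q) dvd s"
  shows "(cyclic_shift :: 'q::{finite,linorder} \<Rightarrow> 'q) ^^ s = id"
proof
  fix j :: 'q
  obtain k where k: "k < CARD('q)" "j = sorted_list_of_set UNIV ! k" by (rule column_nth)
  have "(k + s) mod CARD('q) = k"
    using assms k(1) by (metis add.right_neutral dvd_imp_mod_0 mod_add_right_eq mod_less)
  then show "(cyclic_shift ^^ s) j = id j"
    using cyclic_shift_nth[OF k(1), of s] k(2) by simp
qed

text \<open>This makes the \<open>inv\<close> in \<open>permute_columns\<close> a genuine inverse.
  Finite order gives the shift a right inverse, so it is surjective, and on a finite type also
  injective.\<close>

lemma bij_cyclic_shift_power: "bij ((cyclic_shift :: 'q::{finite,linorder} \<Rightarrow> 'q) ^^ s)"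
proof -
  have "(cyclic_shift :: 'q \<Rightarrow> 'q) ^^ CARD('q) = id"
    by (rule cyclic_shift_power_eq_id) simp
  moreover have "CARD('q) = Suc (CARD('q) - 1)" by simp
  ultimately have "(cyclic_shift :: 'q \<Rightarrow> 'q) \<circ> cyclic_shift ^^ (CARD('q) - 1) = id"
    by (metis funpow.simps(2))
  then have "surj (cyclic_shift :: 'q \<Rightarrow> 'q)"
    by (metis comp_apply id_apply surjI)
  then have "bij (cyclic_shift :: 'q \<Rightarrow> 'q)"
    by (simp add: bij_def finite_UNIV_surj_inj)
  then show ?thesis by (rule bij_fn)
qed

text \<open>The action is free: the power moves index 0 of the sorted list to index
  \<open>s mod CARD('q)\<close>, so fixing \<open>first\<close> forces \<open>s\<close> to be a
  multiple of the group order.\<close>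

lemma cyclic_shift_power_eq_id_iff:
  "(cyclic_shift :: 'q::{finite,linorder} \<Rightarrow> 'q) ^^ s = id \<longleftrightarrow> (cyclic_shift ^^ s) first = (first :: 'q)"
proof
  assume fix_first: "(cyclic_shift ^^ s) first = (first :: 'q)"
  let ?cs = "sorted_list_of_set (UNIV :: 'q set)"
  have "?cs ! (s mod CARD('q)) = ?cs ! 0"
    using fix_first cyclic_shift_nth[where 'q = 'q, of 0 s] by (simp add: first_nth)
  then have "s mod CARD('q) = 0"
    by (simp add: nth_eq_iff_index_eq)
  then show "(cyclic_shift :: 'q \<Rightarrow> 'q) ^^ s = id"
    by (intro cyclic_shift_power_eq_id) auto
qed simp

lemma cyclic_shift_transitive:
  obtains s where "(cyclic_shift ^^ s) (j :: 'q::{finite,linorder}) = first"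
proof -
  obtain k where k: "k < CARD('q)" "j = sorted_list_of_set UNIV ! k" by (rule column_nth)
  \<comment> \<open>Index \<open>k\<close> lands on \<open>CARD('q)\<close>, which is 0 modulo
    \<open>CARD('q)\<close>; for \<open>k = 0\<close> this is a full turn.\<close>
  have "(cyclic_shift ^^ (CARD('q) - k)) j = first"
    using cyclic_shift_nth[OF k(1), of "CARD('q) - k"] k by (simp add: first_nth)
  then show ?thesis by (rule that)
qed

lemma partitioning_matrix_maximal_iff:
  fixes A :: "('p::{finite,linorder}, 'q::{finite,linorder}) rmatrix"
  assumes "A \<in> partitioning_matrices"
  shows "(\<forall>B\<in>cyclic_orbit A. \<not> lex_less A B) \<longleftrightarrow> A $ first $ first = 1"
proof
  assume max: "\<forall>B\<in>cyclic_orbit A. \<not> lex_less A B"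
  obtain j where j: "A $ first $ j = 1"
    using assms unfolding partitioning_matrices_def by blast
  obtain s where s: "(cyclic_shift ^^ s) j = first" by (rule cyclic_shift_transitive)
  define B where "B = permute_columns (cyclic_shift ^^ s) A"
  have "B \<in> cyclic_orbit A" by (auto simp: B_def cyclic_orbit_def cyclic_perms_def)
  then have "\<not> lex_less A B" using max by blast
  moreover have "inv (cyclic_shift ^^ s) first = j"
    using s bij_cyclic_shift_power by (metis bij_inv_eq_iff)
  then have "B $ first $ first = 1" using j by (simp add: B_def permute_columns_def)
  \<comment> \<open>No position precedes the corner, so a smaller corner entry alone would make
    \<open>A\<close> smaller than \<open>B\<close>.\<close>
  ultimately have "\<not> A $ first $ first < 1"
    unfolding lex_less_def using first_le leD by metis
  moreover have "A $ first $ first \<in> {0, 1}"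
    using assms unfolding partitioning_matrices_def by blast
  ultimately show "A $ first $ first = 1" by auto
next
  assume A11: "A $ first $ first = 1"
  show "\<forall>B\<in>cyclic_orbit A. \<not> lex_less A B"
  proof
    fix B assume "B \<in> cyclic_orbit A"
    then obtain s where B: "B = permute_columns (cyclic_shift ^^ s) A"
      by (auto simp: cyclic_orbit_def cyclic_perms_def)
    define j where "j = inv (cyclic_shift ^^ s) (first :: 'q)"
    have B11: "B $ first $ first = A $ first $ j"
      by (simp add: B j_def permute_columns_def)
    show "\<not> lex_less A B"
    proof
      assume less: "lex_less A B"
      then obtain k l where kl: "A $ k $ l < B $ k $ l"
          "\<And>i j. i < k \<or> (i = k \<and> j < l) \<Longrightarrow> A $ i $ j = B $ i $ j"
        unfolding lex_less_def by blast
      have "A $ first $ j \<in> {0, 1}"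
        using assms unfolding partitioning_matrices_def by blast
      then have "A $ first $ j \<le> 1" by auto
      \<comment> \<open>The corner of \<open>A\<close> is already 1, so \<open>B\<close> cannot
        exceed it there. The first difference comes later, hence the corners agree and the rotation
        fixes \<open>first\<close>; by freeness \<open>B = A\<close>.\<close>
      then have "\<not> (k = first \<and> l = first)" using kl(1) A11 B11 by auto
      then have "A $ first $ first = B $ first $ first"
        using kl(2) first_less_iff by metis
      then have "A $ first $ j = 1" using A11 B11 by simp
      then have "j = first"
        using A11 assms unfolding partitioning_matrices_def by blast
      then have "(cyclic_shift ^^ s) first = (first :: 'q)"
        unfolding j_def by (metis bij_cyclic_shift_power bij_inv_eq_iff)
      then have "(cyclic_shift :: 'q \<Rightarrow> 'q) ^^ s = id"
        by (simp only: cyclic_shift_power_eq_id_iff)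
      then have "B = A" by (simp add: B permute_columns_def)
      then show False using kl(1) by simp
    qed
  qed
qed

section \<open>The orbitope as a solution set, via product weights\<close>

definition matrix_of_fun :: "('p::finite \<Rightarrow> 'q::finite) \<Rightarrow> ('p, 'q) rmatrix" where
  "matrix_of_fun f = (\<chi> i j. if f i = j then 1 else 0)"

lemma matrix_of_fun_partitioning: "matrix_of_fun f \<in> partitioning_matrices"
  by (auto simp: matrix_of_fun_def partitioning_matrices_def)

lemma partitioning_matrix_row_sum:
  assumes "A \<in> partitioning_matrices"
  shows "(\<Sum>j\<in>UNIV. A $ i $ j) = 1"
proof -
  obtain j where j: "A $ i $ j = 1" "\<And>j'. A $ i $ j' = 1 \<Longrightarrow> j' = j"
    using assms unfolding partitioning_matrices_def by blast
  have "A $ i $ j' \<in> {0, 1}" for j'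
    using assms unfolding partitioning_matrices_def by blast
  then have "A $ i $ j' = (if j' = j then 1 else 0)" for j'
    using j by (metis insertE singletonD)
  then show ?thesis by simp
qed

lemma prod_sum_UNIV:
  fixes y :: "'p::finite \<Rightarrow> 'q::finite \<Rightarrow> 'r::comm_semiring_1"
  shows "(\<Prod>i\<in>UNIV. \<Sum>j\<in>UNIV. y i j) = (\<Sum>f\<in>UNIV. \<Prod>i\<in>UNIV. y i (f i))"
  using prod_sum_PiE[of UNIV "\<lambda>_. UNIV" y] by (simp add: PiE_UNIV_domain)

text \<open>The indicator can be absorbed into the product by zeroing row \<open>a\<close> outside
  column \<open>b\<close>. The sum over functions then factors into row sums: \<open>x a b\<close>
  for row \<open>a\<close> and 1 for every other row.\<close>

lemma product_weights_marginal:
  fixes x :: "'p::finite \<Rightarrow> 'q::finite \<Rightarrow> real"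
  assumes rows: "\<And>i. (\<Sum>j\<in>UNIV. x i j) = 1"
  shows "(\<Sum>f\<in>UNIV. (\<Prod>i\<in>UNIV. x i (f i)) * (if f a = b then 1 else 0)) = x a b"
proof -
  define y where "y i j = (if i = a \<and> j \<noteq> b then 0 else x i j)" for i j
  have "(\<Prod>i\<in>UNIV. y i (f i)) = (\<Prod>i\<in>UNIV. x i (f i)) * (if f a = b then 1 else 0)" for f
  proof (cases "f a = b")
    case True
    then show ?thesis by (auto simp: y_def intro!: prod.cong)
  next
    case False
    then have "y a (f a) = 0" by (simp add: y_def)
    then show ?thesis using False by (auto intro!: prod_zero)
  qed
  then have "(\<Sum>f\<in>UNIV. (\<Prod>i\<in>UNIV. x i (f i)) * (if f a = b then 1 else 0)) =
      (\<Prod>i\<in>UNIV. \<Sum>j\<in>UNIV. y i j)"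
    by (simp add: prod_sum_UNIV)
  also have "(\<Sum>j\<in>UNIV. y i j) = (if i = a then x a b else 1)" for i
  proof (cases "i = a")
    case True
    then have "y i j = (if j = b then x a b else 0)" for j by (simp add: y_def)
    then show ?thesis using True by simp
  next
    case False
    then show ?thesis using rows by (simp add: y_def)
  qed
  then have "(\<Prod>i\<in>UNIV. \<Sum>j\<in>UNIV. y i j) = x a b" by simp
  finally show ?thesis .
qed

lemma convex_solutions: "convex (solutions S)"
proof -
  have "convex {x. satisfies x c}" for c :: "'a lin_constraint"
    by (cases c) (simp_all add: convex_hyperplane convex_halfspace_ge)
  moreover have "solutions S = (\<Inter>c\<in>S. {x. satisfies x c})"
    by (auto simp: solutions_def)
  ultimately show ?thesis by (auto intro: convex_INT)
qed

lemma partitioning_orbitope_eq_hull: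
  "(partitioning_orbitope :: ('p::{finite,linorder}, 'q::{finite,linorder}) rmatrix set) =
     convex hull {A \<in> partitioning_matrices. A $ first $ first = 1}"
  unfolding partitioning_orbitope_def
  by (rule arg_cong[where f = "\<lambda>V. convex hull V"])
    (use partitioning_matrix_maximal_iff in blast)

lemma partitioning_orbitope_eq_solutions:
  "(partitioning_orbitope :: ('p::{finite,linorder}, 'q::{finite,linorder}) rmatrix set) =
     solutions orbitope_system"
proof
  let ?V = "{A :: ('p, 'q) rmatrix. A \<in> partitioning_matrices \<and> A $ first $ first = 1}"
  have "?V \<subseteq> solutions orbitope_system"
  proof
    fix A assume "A \<in> ?V"
    then have A: "A \<in> partitioning_matrices" "A $ first $ first = 1" by auto
    have entries: "A $ i $ j = 0 \<or> A $ i $ j = 1" for i j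
      using A(1) by (auto simp: partitioning_matrices_def)
    have "A $ first $ j = 0" if "first < j" for j
      using A entries[of first j] that unfolding partitioning_matrices_def by blast
    moreover have "A $ i $ j \<ge> 0" for i j using entries[of i j] by auto
    ultimately show "A \<in> solutions orbitope_system"
      using A by (simp add: solutions_orbitope_system partitioning_matrix_row_sum)
  qed
  then show "(partitioning_orbitope :: ('p, 'q) rmatrix set) \<subseteq> solutions orbitope_system"
    unfolding partitioning_orbitope_eq_hull by (simp add: hull_minimal convex_solutions)
  show "solutions orbitope_system \<subseteq> (partitioning_orbitope :: ('p, 'q) rmatrix set)"
  proof
    fix x :: "('p, 'q) rmatrix" assume "x \<in> solutions orbitope_system"
    then have x11: "x $ first $ first = 1" and x1: "\<And>j. j \<noteq> first \<Longrightarrow> x $ first $ j = 0"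
      and nonneg': "\<And>i j. i \<noteq> first \<Longrightarrow> x $ i $ j \<ge> 0"
      and rows': "\<And>i. i \<noteq> first \<Longrightarrow> (\<Sum>j\<in>UNIV. x $ i $ j) = 1"
      by (auto simp: solutions_orbitope_system first_less_iff)
    have row1: "x $ first $ j = (if j = first then 1 else 0)" for j
      using x11 x1 by simp
    have nonneg: "x $ i $ j \<ge> 0" for i j
      using nonneg'[of i j] row1[of j] by (cases "i = first") auto
    have rows: "(\<Sum>j\<in>UNIV. x $ i $ j) = 1" for i
      using rows'[of i] row1 by (cases "i = first") auto
    define w where "w f = (\<Prod>i\<in>UNIV. x $ i $ f i)" for f :: "'p \<Rightarrow> 'q"
    define F where "F = {f :: 'p \<Rightarrow> 'q. f first = first}"
    \<comment> \<open>The first row of \<open>x\<close> is the first unit vector, so the factor of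
      row \<open>first\<close> vanishes. Sums over \<open>F\<close> thus extend to all functions,
      where the product formulas apply.\<close>
    have w_zero: "w f = 0" if "f \<notin> F" for f
      using that row1[of "f first"] by (auto simp: w_def F_def intro!: prod_zero)
    have restrict: "(\<Sum>f\<in>F. w f * g f) = (\<Sum>f\<in>UNIV. w f * g f)" for g
      by (rule sum.mono_neutral_left) (auto simp: w_zero)
    have "(\<Sum>f\<in>F. w f) = 1"
      using restrict[of "\<lambda>_. 1"] prod_sum_UNIV[of "\<lambda>i j. x $ i $ j"] rows by (simp add: w_def)
    moreover have "w f \<ge> 0" for f
      unfolding w_def by (intro prod_nonneg) (simp add: nonneg)
    moreover have "matrix_of_fun f \<in> ?V" if "f \<in> F" for f
      using that matrix_of_fun_partitioning[of f] by (simp add: F_def matrix_of_fun_def)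
    ultimately have "(\<Sum>f\<in>F. w f *\<^sub>R matrix_of_fun f) \<in> convex hull ?V"
      by (intro convex_sum) (auto intro: hull_inc)
    moreover have "(\<Sum>f\<in>F. w f *\<^sub>R matrix_of_fun f) $ i $ j = x $ i $ j" for i j
      using product_weights_marginal[of "\<lambda>i j. x $ i $ j" i j] rows
        restrict[of "\<lambda>f. if f i = j then 1 else 0"]
      by (simp add: matrix_of_fun_def w_def)
    then have "(\<Sum>f\<in>F. w f *\<^sub>R matrix_of_fun f) = x" by (simp add: vec_eq_iff)
    ultimately show "x \<in> partitioning_orbitope" by (simp add: partitioning_orbitope_eq_hull)
  qed
qed

section \<open>Non-redundancy of the system\<close>

lemma nonredundantI:
  assumes "\<And>c. c \<in> S \<Longrightarrow> \<exists>x. \<not> satisfies x c \<and> (\<forall>c'\<in>S - {c}. satisfies x c')"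
  shows "nonredundant S"
  using assms unfolding nonredundant_def solutions_def by blast

text \<open>The unmodified matrix, with ones exactly in the first column, solves the system, so only
  constraints on row \<open>a\<close> can fail.\<close>

definition replace_row :: "'p \<Rightarrow> ('q \<Rightarrow> real) \<Rightarrow> ('p::finite, 'q::{finite,linorder}) rmatrix" where
  "replace_row a r = (\<chi> i j. if i = a then r j else if j = first then 1 else 0)"

text \<open>Each premise on \<open>r\<close> is guarded by the form of \<open>c\<close>. When
  \<open>c\<close> ranges over the system without one constraint, the premise that \<open>r\<close>
  violates becomes vacuous.\<close>

lemma replace_row_satisfies:
  fixes c :: "('p::{finite,linorder}, 'q::{finite,linorder}) rmatrix lin_constraint"
  assumes "c \<in> orbitope_system"
    and corner: "\<lbrakk>c = LinEq (form_of {(first, first)}) 1; a = first\<rbrakk> \<Longrightarrow> r first = 1"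
    and zero: "\<And>b. \<lbrakk>c = LinEq (form_of {(first, b)}) 0; b > first; a = first\<rbrakk> \<Longrightarrow> r b = 0"
    and nonneg: "\<And>b. \<lbrakk>c = LinGe (form_of {(a, b)}) 0; a > first\<rbrakk> \<Longrightarrow> r b \<ge> 0"
    and row: "\<lbrakk>c = LinEq (form_of (row_positions a)) 1; a > first\<rbrakk> \<Longrightarrow> (\<Sum>j\<in>UNIV. r j) = 1"
  shows "satisfies (replace_row a r) c"
proof -
  have row_sum: "form_of (row_positions i) \<bullet> replace_row a r = (if i = a then \<Sum>j\<in>UNIV. r j else 1)"
    for i
    by (simp add: form_of_inner row_positions_def sum.cartesian_product[symmetric] replace_row_def)
  have entry: "form_of {(i, j)} \<bullet> replace_row a r = (if i = a then r j else if j = first then 1 else 0)"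
    for i j
    by (simp add: form_of_inner replace_row_def)
  show ?thesis
    using assms by (auto simp: orbitope_system_def row_sum entry)
qed

lemma nonredundant_orbitope_system:
  assumes "CARD('q) \<ge> 2 \<or> CARD('p) = 1"
  shows "nonredundant
    (orbitope_system :: ('p::{finite,linorder}, 'q::{finite,linorder}) rmatrix lin_constraint set)"
proof (rule nonredundantI)
  fix c :: "('p, 'q) rmatrix lin_constraint"
  assume "c \<in> orbitope_system"
  then consider (corner) "c = LinEq (form_of {(first, first)}) 1"
    | (zero) b where "b > first" "c = LinEq (form_of {(first, b)}) 0"
    | (nonneg) a b where "a > first" "c = LinGe (form_of {(a, b)}) 0"
    | (row) a where "a > first" "c = LinEq (form_of (row_positions a)) 1"
    by (auto simp: orbitope_system_def)
  then show "\<exists>x. \<not> satisfies x c \<and> (\<forall>c'\<in>orbitope_system - {c}. satisfies x c')"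
  proof cases
    case corner
    have "\<not> satisfies (replace_row first (\<lambda>_. 0)) c"
      by (simp add: corner form_of_inner replace_row_def)
    moreover have "satisfies (replace_row first (\<lambda>_. 0)) c'" if "c' \<in> orbitope_system - {c}" for c'
      by (rule replace_row_satisfies) (use that corner in auto)
    ultimately show ?thesis by blast
  next
    case zero
    \<comment> \<open>Row sum 2 is harmless, since no row-sum equation is imposed on row
      \<open>first\<close>.\<close>
    define r where "r j = (if j = first \<or> j = b then 1 else 0 :: real)" for j
    have "\<not> satisfies (replace_row first r) c"
      by (simp add: zero form_of_inner replace_row_def r_def)
    moreover have "satisfies (replace_row first r) c'" if "c' \<in> orbitope_system - {c}" for c'
      by (rule replace_row_satisfies) (use that zero in \<open>auto simp: r_def\<close>)
    ultimately show ?thesis by blast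
  next
    case nonneg
    \<comment> \<open>A row beyond \<open>first\<close> excludes \<open>CARD('p) = 1\<close>, so the
      hypothesis supplies a second column.\<close>
    have "CARD('p) \<noteq> 1"
      using nonneg(1) by (metis UNIV_I card_1_singletonE less_irrefl singletonD)
    then have "CARD('q) \<ge> 2" using assms by simp
    then have "UNIV \<noteq> {b}" by (metis card.empty card.insert card_1_singleton_iff
        One_nat_def numeral_le_one_iff semiring_norm(69))
    then obtain b' where b': "b' \<noteq> b" by blast
    \<comment> \<open>The entry -1 at \<open>b\<close> is balanced by 2 at \<open>b'\<close>, which
      keeps the row sum 1 and leaves \<open>b\<close> as the only negative entry.\<close>
    define r where "r j = (if j = b then - 1 else 0) + (if j = b' then 2 else 0 :: real)" for j
    have r_sum: "(\<Sum>j\<in>UNIV. r j) = 1" by (simp add: r_def sum.distrib)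
    have "\<not> satisfies (replace_row a r) c"
      using b' by (simp add: nonneg form_of_inner replace_row_def r_def)
    moreover have "satisfies (replace_row a r) c'" if "c' \<in> orbitope_system - {c}" for c'
      by (rule replace_row_satisfies) (use that nonneg r_sum in \<open>auto simp: r_def\<close>)
    ultimately show ?thesis by blast
  next
    case row
    \<comment> \<open>A zero row is nonnegative, so it violates only its own row-sum
      equation.\<close>
    have "\<not> satisfies (replace_row a (\<lambda>_. 0)) c"
      by (simp add: row form_of_inner row_positions_def replace_row_def
          sum.cartesian_product[symmetric])
    moreover have "satisfies (replace_row a (\<lambda>_. 0)) c'" if "c' \<in> orbitope_system - {c}" for c'
      by (rule replace_row_satisfies) (use that row in auto)
    ultimately show ?thesis by blast
  qed
qed

theorem theorem3:
  shows "(partitioning_orbitope :: ('p::{finite,linorder}, 'q::{finite,linorder}) rmatrix set)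
           = solutions orbitope_system \<and>
         (CARD('q) \<ge> 2 \<or> CARD('p) = 1 \<longrightarrow>
           nonredundant (orbitope_system :: ('p, 'q) rmatrix lin_constraint set))"
  using partitioning_orbitope_eq_solutions nonredundant_orbitope_system by blast

end
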